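(* Let $q>1$ and let $\tilde m=(\tilde m(n))_{n\ge 0}$ be a sequence of positive real numbers with $\tilde m(0)=1$ that preserves $q$-Gevrey asymptotic expansions. Let $m=(m(n))_{n\ge 0}$ be a sequence of positive real numbers with $m(0)=1$ such that for every $s>0$ there exist $A_s,B_s>0$ and $\alpha_s\in\mathbb{R}$ satisfying $$|m(n)-\tilde m(n)|\le \frac{A_sB_s^n(n!)^{\alpha_s}}{q^{s\frac{n(n-1)}{2}}}\quad\text{for every } n\in\mathbb{N}_0 .$$ Then $m$ also preserves $q$-Gevrey asymptotic expansions.
   Context: Let $\mathbb{E}$ be a complex Banach space with norm $\|\cdot\|_{\mathbb{E}}$, $\mathbb{E}[[t]]$ the space of formal power series with coefficients in $\mathbb{E}$, and $\mathbb{E}\{t\}$ the space of convergent ones. For a sequence $m$ of positive numbers, $\mathcal{B}_m(\sum_{n\ge0} a_nt^n)=\sum_{n\ge0}\frac{a_n}{m(n)}t^n$. Fix $q>1$. For $s>0$ the formal $q$-Borel transformation of order $s$ is $\mathcal{B}_{q;s}(\sum_{n\ge0} a_nt^n)=\sum_{n\ge0}\frac{a_n}{q^{s n(n-1)/2}}t^n$. A holomorphic $\mathbb{E}$-valued function $f$ is of $q$-exponential growth of order $1/s$ on an unbounded sector if there exist $C,h>0$ and $\alpha\in\mathbb{R}$ with $$\|f(t)\|_{\mathbb{E}}\le C\exp\Big(\frac{\log^2(|t|+h)}{2s\log q}\Big)(|t|+h)^{\alpha}$$ for all $t$ in the sector. A sequence $m$ of positive numbers preserves $q$-Gevrey asymptotic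 expansions if for every $s>0$, $d\in\mathbb{R}$ and $\hat u\in\mathbb{E}[[t]]$ the following are equivalent: (i) $\mathcal{B}_{q;s}(\hat u)\in\mathbb{E}\{t\}$ and its sum extends analytically to an infinite sector (vertex $0$, positive opening) with bisecting direction $d$, with $q$-exponential growth of order $1/s$ on that sector; (ii) $\mathcal{B}_{q;s}\mathcal{B}_m(\hat u)\in\mathbb{E}\{t\}$ and its sum extends analytically to an infinite sector with bisecting direction $d$, with $q$-exponential growth of order $1/s$ on that sector. *)

theory Defs
  imports "HOL-Analysis.Analysis" "HOL-Computational_Algebra.Formal_Power_Series"
begin

text \<open>Complex Banach spaces: a real Banach space whose real scalar multiplication and norm are
  those induced by a complex scalar multiplication.\<close>

class complex_banach = banach +
  fixes scaleC :: "complex \<Rightarrow> 'a \<Rightarrow> 'a" (infixr "*\<^sub>C" 75)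
  assumes scaleC_add_right: "a *\<^sub>C (x + y) = a *\<^sub>C x + a *\<^sub>C y"
    and scaleC_add_left: "(a + b) *\<^sub>C x = a *\<^sub>C x + b *\<^sub>C x"
    and scaleC_scaleC: "a *\<^sub>C b *\<^sub>C x = (a * b) *\<^sub>C x"
    and scaleC_one: "1 *\<^sub>C x = x"
    and scaleR_scaleC: "r *\<^sub>R x = complex_of_real r *\<^sub>C x"
    and norm_scaleC: "norm (a *\<^sub>C x) = cmod a * norm x"

instantiation complex :: complex_banach
begin

definition scaleC_complex :: "complex \<Rightarrow> complex \<Rightarrow> complex"
  where "scaleC_complex a x = a * x"

instance
  by standard (simp_all add: scaleC_complex_def algebra_simps norm_mult scaleR_conv_of_real)

end

text \<open>The library predicate \<open>holomorphic_on\<close> only covers complex-valued functions.\<close>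

definition vholomorphic_on :: "(complex \<Rightarrow> 'e::complex_banach) \<Rightarrow> complex set \<Rightarrow> bool"
  where "vholomorphic_on f S \<longleftrightarrow> (\<forall>z\<in>S. \<exists>D. (f has_derivative (\<lambda>h. h *\<^sub>C D)) (at z within S))"

definition moment_borel :: "(nat \<Rightarrow> real) \<Rightarrow> 'e::complex_banach fps \<Rightarrow> 'e fps"
  where "moment_borel m u = Abs_fps (\<lambda>n. fps_nth u n /\<^sub>R m n)"

text \<open>The exponent is real, so that there is no truncated subtraction at \<open>n = 0\<close>.\<close>

definition q_borel :: "real \<Rightarrow> real \<Rightarrow> 'e::complex_banach fps \<Rightarrow> 'e fps"
  where "q_borel q s = moment_borel (\<lambda>n. q powr (s * (real n * (real n - 1) / 2)))"

definition fps_convergent :: "'e::complex_banach fps \<Rightarrow> bool"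
  where "fps_convergent u \<longleftrightarrow> (\<exists>r>0. \<forall>z\<in>ball 0 r. summable (\<lambda>n. z ^ n *\<^sub>C fps_nth u n))"

text \<open>The infinite open sector with vertex \<open>0\<close>, bisecting direction \<open>d\<close> and opening \<open>\<theta>\<close>,
  as a subset of the plane; it is meaningful for \<open>0 < \<theta> \<le> 2\<pi>\<close>.\<close>

definition sector :: "real \<Rightarrow> real \<Rightarrow> complex set"
  where "sector d \<theta> = {complex_of_real r * cis \<phi> | r \<phi>. 0 < r \<and> \<bar>\<phi> - d\<bar> < \<theta> / 2}"

text \<open>\<open>q\<close>-exponential growth of order \<open>1/s\<close> on \<open>S\<close> (the parameter is \<open>s\<close>, not its inverse).\<close>

definition q_exp_growth_on :: "real \<Rightarrow> real \<Rightarrow> (complex \<Rightarrow> 'e::complex_banach) \<Rightarrow> complex set \<Rightarrow> bool"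
  where "q_exp_growth_on q s f S \<longleftrightarrow>
    (\<exists>C>0. \<exists>h>0. \<exists>\<alpha>::real. \<forall>t\<in>S.
       norm (f t) \<le> C * exp ((ln (cmod t + h))\<^sup>2 / (2 * s * ln q)) * (cmod t + h) powr \<alpha>)"

text \<open>The series \<open>u\<close> converges near \<open>0\<close> and its sum extends analytically to an infinite sector with
  bisecting direction \<open>d\<close>, with \<open>q\<close>-exponential growth of order \<open>1/s\<close> there.  Since the disc meets the
  sector in a connected set, the extension may be given as one function on the union.\<close>

definition extends_with_q_growth :: "real \<Rightarrow> real \<Rightarrow> real \<Rightarrow> 'e::complex_banach fps \<Rightarrow> bool"
  where "extends_with_q_growth q s d u \<longleftrightarrow>
    fps_convergent u \<and>
    (\<exists>\<theta> r f. 0 < \<theta> \<and> \<theta> \<le> 2 * pi \<and> 0 < r \<and>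
       vholomorphic_on f (ball 0 r \<union> sector d \<theta>) \<and>
       (\<forall>z\<in>ball 0 r. (\<lambda>n. z ^ n *\<^sub>C fps_nth u n) sums f z) \<and>
       q_exp_growth_on q s f (sector d \<theta>))"

text \<open>The type argument fixes the coefficient space; \<open>m\<close> is meant to be a sequence of positive
  numbers and \<open>q > 1\<close>.\<close>

definition preserves_q_gevrey :: "'e::complex_banach itself \<Rightarrow> real \<Rightarrow> (nat \<Rightarrow> real) \<Rightarrow> bool"
  where "preserves_q_gevrey (E :: 'e itself) q m \<longleftrightarrow>
    (\<forall>s>0. \<forall>d. \<forall>u :: 'e fps.
       extends_with_q_growth q s d (q_borel q s u) \<longleftrightarrow>
       extends_with_q_growth q s d (q_borel q s (moment_borel m u)))"

end

theory Submission
  imports Defs "HOL-Real_Asymp.Real_Asymp"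
begin

text \<open>Applying preservation to the geometric series \<open>a / (1 - t)\<close> in the direction \<open>\<pi>\<close> shows that
  \<open>1 / m' n\<close> grows at most geometrically.  Hence \<open>m n / m' n\<close> and \<open>m' n / m n\<close> differ from \<open>1\<close> by
  a quantity smaller than \<open>q powr (- s * n\<^sup>2 / 2)\<close> for every \<open>s\<close>, and replacing \<open>m'\<close> by \<open>m\<close> in the
  Borel transform adds an entire function of \<open>q\<close>-exponential growth of order \<open>1/s\<close>.\<close>

section \<open>Vector-valued power series and elementary real estimates\<close>

lemma bounded_bilinear_scaleC:
  "bounded_bilinear (scaleC :: complex \<Rightarrow> 'e::complex_banach \<Rightarrow> 'e)"
proof
  fix a a' :: complex and b b' :: 'e and r :: real
  show "(a + a') *\<^sub>C b = a *\<^sub>C b + a' *\<^sub>C b" by (rule scaleC_add_left)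
  show "a *\<^sub>C (b + b') = a *\<^sub>C b + a *\<^sub>C b'" by (rule scaleC_add_right)
  show "(r *\<^sub>R a) *\<^sub>C b = r *\<^sub>R (a *\<^sub>C b)"
    by (simp add: scaleR_scaleC[of r "a *\<^sub>C b"] scaleC_scaleC scaleR_conv_of_real)
  show "a *\<^sub>C (r *\<^sub>R b) = r *\<^sub>R (a *\<^sub>C b)"
    by (simp add: scaleR_scaleC scaleC_scaleC mult.commute)
  show "\<exists>K. \<forall>a b. norm (a *\<^sub>C b :: 'e) \<le> norm a * norm b * K"
    by (rule exI[of _ 1]) (simp add: norm_scaleC)
qed

interpretation scaleC: bounded_bilinear "scaleC :: complex \<Rightarrow> 'e::complex_banach \<Rightarrow> 'e"
  by (rule bounded_bilinear_scaleC)

text \<open>Termwise differentiation: on the disc of radius \<open>cmod z + 1\<close> the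
  differentiated series converges uniformly by the M-test. Since \<open>z\<close> is arbitrary, the
  sum is entire in the sense required by \<open>vholomorphic_on\<close>.\<close>

lemma has_derivative_powser_scaleC:
  fixes c :: "nat \<Rightarrow> 'e::complex_banach"
  assumes "\<And>x::real. summable (\<lambda>n. norm (c n) * x ^ n)"
  shows "((\<lambda>z. \<Sum>n. z ^ n *\<^sub>C c n) has_derivative
      (\<lambda>h. h *\<^sub>C (\<Sum>n. (of_nat n * z ^ (n - 1)) *\<^sub>C c n))) (at z)"
proof -
  define R where "R = cmod z + 1"
  have R: "R > 0" "z \<in> ball 0 R" by (auto simp: R_def intro: add_nonneg_pos)
  let ?d = "\<lambda>n (x::complex). (of_nat n * x ^ (n - 1)) *\<^sub>C c n"
  define M where "M n = real n * R ^ (n - 1) * norm (c n)" for n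
  \<comment> \<open>The formally differentiated real majorant converges everywhere; its
    \<open>n\<close>-th term is \<open>M (Suc n)\<close>, and a shift of the index does not affect
    summability.\<close>
  have "summable (\<lambda>n. diffs (\<lambda>n. norm (c n)) n * R ^ n)"
    using assms by (intro termdiff_converges_all) auto
  then have "summable (\<lambda>n. M (Suc n))"
    by (simp add: diffs_def M_def mult_ac)
  then have M: "summable M" by (simp only: summable_Suc_iff)
  have bound: "norm (?d n x) \<le> M n" if "x \<in> ball 0 R" for n x
    using that by (auto simp: M_def norm_scaleC norm_mult norm_power
        intro!: mult_right_mono mult_left_mono power_mono)
  have unif: "uniform_limit (ball 0 R) (\<lambda>n x. \<Sum>i<n. ?d i x) (\<lambda>x. suminf (\<lambda>n. ?d n x)) sequentially"
    using bound M by (rule Weierstrass_m_test)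
  have "\<exists>g. \<forall>x\<in>ball 0 R. (\<lambda>n. x ^ n *\<^sub>C c n) sums g x \<and>
      (g has_derivative (\<lambda>h. h *\<^sub>C (\<Sum>n. ?d n x))) (at x within ball 0 R)"
  proof (rule has_derivative_series)
    show "convex (ball (0::complex) R)" by simp
    show "((\<lambda>x. x ^ n *\<^sub>C c n) has_derivative (\<lambda>h. h *\<^sub>C ?d n x)) (at x within ball 0 R)" for n x
    proof -
      have "((\<lambda>x. x ^ n) has_derivative (\<lambda>h. of_nat n * x ^ (n - 1) * h)) (at x within ball 0 R)"
        by (auto intro!: derivative_eq_intros simp: mult_ac)
      from bounded_linear.has_derivative[OF scaleC.bounded_linear_left this, of "c n"]
      show ?thesis by (simp add: scaleC_scaleC mult.commute)
    qed
    show "\<forall>\<^sub>F n in sequentially. \<forall>x\<in>ball 0 R. \<forall>h.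
        norm ((\<Sum>i<n. h *\<^sub>C ?d i x) - h *\<^sub>C (\<Sum>n. ?d n x)) \<le> e * norm h" if "e > 0" for e
      using uniform_limitD[OF unif that]
    proof eventually_elim
      case (elim n)
      show ?case
      proof (intro ballI allI)
        fix x h :: complex assume "x \<in> ball 0 R"
        with elim have "norm ((\<Sum>i<n. ?d i x) - (\<Sum>n. ?d n x)) \<le> e"
          by (force simp: dist_norm)
        then have "cmod h * norm ((\<Sum>i<n. ?d i x) - (\<Sum>n. ?d n x)) \<le> cmod h * e"
          by (rule mult_left_mono) simp
        then show "norm ((\<Sum>i<n. h *\<^sub>C ?d i x) - h *\<^sub>C (\<Sum>n. ?d n x)) \<le> e * norm h"
          by (simp add: scaleC.sum_right[symmetric] scaleC.diff_right[symmetric] norm_scaleC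
              mult.commute)
      qed
    qed
    show "(0::complex) \<in> ball 0 R" using R by simp
    \<comment> \<open>Termwise differentiation needs one point of convergence; at 0 only the
      constant term survives.\<close>
    show "(\<lambda>n. 0 ^ n *\<^sub>C c n) sums (\<Sum>n. 0 ^ n *\<^sub>C c n)"
      by (rule summable_sums[OF summable_finite[of "{0}"]])
        (auto simp: power_0_left scaleC.zero_left)
  qed
  then obtain g where g: "\<And>x. x \<in> ball 0 R \<Longrightarrow> (\<lambda>n. x ^ n *\<^sub>C c n) sums g x"
    "\<And>x. x \<in> ball 0 R \<Longrightarrow> (g has_derivative (\<lambda>h. h *\<^sub>C (\<Sum>n. ?d n x))) (at x within ball 0 R)"
    by blast
  have "(g has_derivative (\<lambda>h. h *\<^sub>C (\<Sum>n. ?d n z))) (at z)"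
    using g(2)[OF R(2)] unfolding at_within_open[OF R(2) open_ball] .
  then show ?thesis
    by (rule has_derivative_transform_within_open[OF _ open_ball R(2)])
      (simp add: g(1) sums_unique)
qed

text \<open>AM-GM: \<open>n * ln x \<le> s * n\<^sup>2 * ln q / 2 + (ln x)\<^sup>2 / (2 * s * ln q)\<close>.\<close>

lemma power_le_q_exp:
  fixes q s x :: real
  assumes "q > 1" "s > 0" "x > 0"
  shows "x ^ n \<le> q powr (s * (real n)\<^sup>2 / 2) * exp ((ln x)\<^sup>2 / (2 * s * ln q))"
proof -
  define l where "l = s * ln q"
  have l: "l > 0" using assms by (simp add: l_def)
  have "0 \<le> (l * n - ln x)\<^sup>2 / (2 * l)" using l by simp
  also have "\<dots> = l * (real n)\<^sup>2 / 2 + (ln x)\<^sup>2 / (2 * l) - n * ln x"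
    using l by (simp add: field_simps power2_eq_square)
  finally have "n * ln x \<le> l * (real n)\<^sup>2 / 2 + (ln x)\<^sup>2 / (2 * l)" by simp
  moreover have "x ^ n = exp (n * ln x)"
    using assms by (simp add: exp_of_nat_mult)
  ultimately show ?thesis
    using assms by (simp add: powr_def l_def exp_add[symmetric] mult_ac)
qed

text \<open>Serves to bring powers with different exponents to a common larger one. As
  \<open>x\<close> may be below 1, monotonicity in the exponent fails; instead
  \<open>x powr (\<alpha> - \<beta>)\<close> is nonincreasing in \<open>x\<close>, hence at most its
  value at \<open>h\<close>.\<close>

lemma powr_le_powr_mult:
  fixes h x \<alpha> \<beta> :: real
  assumes "0 < h" "h \<le> x" "\<alpha> \<le> \<beta>"
  shows "x powr \<alpha> \<le> h powr (\<alpha> - \<beta>) * x powr \<beta>"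
proof -
  have "x powr \<alpha> = x powr (\<alpha> - \<beta>) * x powr \<beta>"
    using assms by (simp add: powr_add[symmetric])
  also have "\<dots> \<le> h powr (\<alpha> - \<beta>) * x powr \<beta>"
    using assms by (intro mult_right_mono powr_mono2') auto
  finally show ?thesis .
qed

section \<open>Perturbation by entire functions of q-exponential growth\<close>

text \<open>The weight in the assumption on \<open>c\<close> is the factor that AM-GM produces for
  \<open>x ^ n\<close>. Summing termwise, \<open>c\<close> defines an entire function bounded by a
  constant times the exponential in the growth condition, so it can be added to the extension of
  \<open>v\<close> on the same disc and sector.\<close>

lemma extends_with_q_growth_add:
  fixes v c :: "'e::complex_banach fps"
  assumes q: "q > 1" and s: "s > 0"
    and v: "extends_with_q_growth q s d v"
    and c: "summable (\<lambda>n. norm (fps_nth c n) * q powr (s * (real n)\<^sup>2 / 2))"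
  shows "extends_with_q_growth q s d (v + c)"
proof -
  let ?c = "\<lambda>n. norm (fps_nth c n)"
  define M where "M = (\<Sum>n. ?c n * q powr (s * (real n)\<^sup>2 / 2))"
  have M0: "M \<ge> 0" unfolding M_def using c by (intro suminf_nonneg) auto
  \<comment> \<open>Separating \<open>y\<close> from \<open>x\<close> admits \<open>y = 0\<close>,
    while the logarithm is taken at the positive number \<open>x\<close>.\<close>
  have term_le: "?c n * y ^ n \<le>
      ?c n * q powr (s * (real n)\<^sup>2 / 2) * exp ((ln x)\<^sup>2 / (2 * s * ln q))"
    if "0 \<le> y" "y \<le> x" "0 < x" for x y n
  proof -
    have "y ^ n \<le> x ^ n" using that by (intro power_mono)
    also have "\<dots> \<le> q powr (s * (real n)\<^sup>2 / 2) * exp ((ln x)\<^sup>2 / (2 * s * ln q))"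
      using q s that by (intro power_le_q_exp)
    finally show ?thesis by (simp add: mult_left_mono mult.assoc)
  qed
  have summ: "summable (\<lambda>n. ?c n * x ^ n)" for x :: real
  proof (rule summable_comparison_test'[where N = 0])
    show "summable (\<lambda>n. ?c n * q powr (s * (real n)\<^sup>2 / 2) *
        exp ((ln (\<bar>x\<bar> + 1))\<^sup>2 / (2 * s * ln q)))"
      by (rule summable_mult2[OF c])
    show "norm (?c n * x ^ n) \<le> ?c n * q powr (s * (real n)\<^sup>2 / 2) *
        exp ((ln (\<bar>x\<bar> + 1))\<^sup>2 / (2 * s * ln q))" for n
      using term_le[of "\<bar>x\<bar>" "\<bar>x\<bar> + 1" n] by (simp add: abs_mult power_abs)
  qed
  define G where "G z = (\<Sum>n. z ^ n *\<^sub>C fps_nth c n)" for z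
  have abssum: "summable (\<lambda>n. norm (z ^ n *\<^sub>C fps_nth c n))" for z
    using summ[of "cmod z"] by (simp add: norm_scaleC norm_power mult.commute)
  have G_sums: "(\<lambda>n. z ^ n *\<^sub>C fps_nth c n) sums G z" for z
    unfolding G_def by (rule summable_sums[OF summable_norm_cancel[OF abssum]])
  \<comment> \<open>The shift \<open>h\<close> is left free so that it can be matched with the one
    in the growth bound for \<open>f\<close>.\<close>
  have G_bound: "norm (G t) \<le> M * exp ((ln (cmod t + h))\<^sup>2 / (2 * s * ln q))" if "h > 0" for h t
  proof -
    have "norm (G t) \<le> (\<Sum>n. norm (t ^ n *\<^sub>C fps_nth c n))"
      unfolding G_def by (rule summable_norm[OF abssum])
    also have "\<dots> \<le> (\<Sum>n. ?c n * q powr (s * (real n)\<^sup>2 / 2) *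
        exp ((ln (cmod t + h))\<^sup>2 / (2 * s * ln q)))"
    proof (rule suminf_le[OF _ abssum summable_mult2[OF c]])
      show "norm (t ^ n *\<^sub>C fps_nth c n) \<le> ?c n * q powr (s * (real n)\<^sup>2 / 2) *
        exp ((ln (cmod t + h))\<^sup>2 / (2 * s * ln q))" for n
        using term_le[of "cmod t" "cmod t + h" n] that
        by (simp add: norm_scaleC norm_power mult_ac add_nonneg_pos)
    qed
    also have "\<dots> = M * exp ((ln (cmod t + h))\<^sup>2 / (2 * s * ln q))"
      unfolding M_def by (rule suminf_mult2[OF c, symmetric])
    finally show ?thesis .
  qed
  from v obtain \<theta> r f where f: "0 < \<theta>" "\<theta> \<le> 2 * pi" "0 < r"
    "vholomorphic_on f (ball 0 r \<union> sector d \<theta>)"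
    "\<And>z. z \<in> ball 0 r \<Longrightarrow> (\<lambda>n. z ^ n *\<^sub>C fps_nth v n) sums f z"
    "q_exp_growth_on q s f (sector d \<theta>)"
    unfolding extends_with_q_growth_def by blast
  from f(6) obtain C h \<alpha> where C: "C > 0" "h > 0"
    "\<And>t. t \<in> sector d \<theta> \<Longrightarrow>
       norm (f t) \<le> C * exp ((ln (cmod t + h))\<^sup>2 / (2 * s * ln q)) * (cmod t + h) powr \<alpha>"
    unfolding q_exp_growth_on_def by blast
  have sums: "(\<lambda>n. z ^ n *\<^sub>C fps_nth (v + c) n) sums (f z + G z)" if "z \<in> ball 0 r" for z
    using sums_add[OF f(5)[OF that] G_sums[of z]] by (simp add: scaleC_add_right)
  have "vholomorphic_on (\<lambda>z. f z + G z) (ball 0 r \<union> sector d \<theta>)"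
    unfolding vholomorphic_on_def
  proof
    fix z assume "z \<in> ball 0 r \<union> sector d \<theta>"
    with f(4) obtain D where
      "(f has_derivative (\<lambda>h. h *\<^sub>C D)) (at z within (ball 0 r \<union> sector d \<theta>))"
      unfolding vholomorphic_on_def by blast
    moreover obtain D' where "(G has_derivative (\<lambda>h. h *\<^sub>C D')) (at z)"
      unfolding G_def using has_derivative_powser_scaleC[OF summ] by blast
    ultimately have "((\<lambda>z. f z + G z) has_derivative (\<lambda>h. h *\<^sub>C D + h *\<^sub>C D'))
        (at z within (ball 0 r \<union> sector d \<theta>))"
      by (rule has_derivative_add[OF _ has_derivative_at_withinI])
    then show "\<exists>D. ((\<lambda>z. f z + G z) has_derivative (\<lambda>h. h *\<^sub>C D))
        (at z within (ball 0 r \<union> sector d \<theta>))"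
      by (intro exI[of _ "D + D'"]) (simp add: scaleC_add_right)
  qed
  moreover have "q_exp_growth_on q s (\<lambda>z. f z + G z) (sector d \<theta>)"
    unfolding q_exp_growth_on_def
  proof (intro exI conjI ballI)
    \<comment> \<open>The bound for \<open>f\<close> has exponent \<alpha> and the one for
      \<open>G\<close> has exponent 0. Raising both to \<open>\<bar>\<alpha>\<bar>\<close> costs the
      two powers of \<open>h\<close> seen here.\<close>
    let ?K = "C * h powr (\<alpha> - \<bar>\<alpha>\<bar>) + M * h powr (0 - \<bar>\<alpha>\<bar>)"
    show "?K > 0" "h > 0" using C M0 by (auto intro!: add_pos_nonneg)
    fix t assume t: "t \<in> sector d \<theta>"
    let ?e = "exp ((ln (cmod t + h))\<^sup>2 / (2 * s * ln q))" and ?x = "cmod t + h"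
    have x: "h \<le> ?x" "?x > 0" using C by (auto intro: add_nonneg_pos)
    have "norm (f t) \<le> C * ?e * (h powr (\<alpha> - \<bar>\<alpha>\<bar>) * ?x powr \<bar>\<alpha>\<bar>)"
      using C(1) by (intro order.trans[OF C(3)[OF t]] mult_left_mono powr_le_powr_mult C x) auto
    moreover have "norm (G t) \<le> M * ?e * (h powr (0 - \<bar>\<alpha>\<bar>) * ?x powr \<bar>\<alpha>\<bar>)"
    proof -
      have "1 \<le> h powr (0 - \<bar>\<alpha>\<bar>) * ?x powr \<bar>\<alpha>\<bar>"
        using powr_le_powr_mult[OF C(2) x(1), of 0 "\<bar>\<alpha>\<bar>"] x(2) by simp
      then have "M * ?e * 1 \<le> M * ?e * (h powr (0 - \<bar>\<alpha>\<bar>) * ?x powr \<bar>\<alpha>\<bar>)"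
        using M0 by (intro mult_left_mono) auto
      with G_bound[OF C(2), of t] show ?thesis by simp
    qed
    ultimately show "norm (f t + G t) \<le> ?K * ?e * ?x powr \<bar>\<alpha>\<bar>"
      using norm_triangle_ineq[of "f t" "G t"] by (simp add: algebra_simps)
  qed
  moreover have "fps_convergent (v + c)"
    unfolding fps_convergent_def using f(3) sums sums_summable by blast
  ultimately show ?thesis
    unfolding extends_with_q_growth_def using f sums by blast
qed

section \<open>Coefficient bounds and the geometric test series\<close>

text \<open>The terms of a convergent series are bounded; evaluating at radius \<open>r / 2\<close>
  gives the rate \<open>2 / r\<close>.\<close>

lemma fps_convergent_geometric_bound:
  assumes "fps_convergent u"
  obtains K R where "K > 0" "R > 0" "\<And>n. norm (fps_nth u n) \<le> K * R ^ n"
proof -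
  from assms[unfolded fps_convergent_def] obtain r where r: "r > 0"
    "\<forall>z\<in>ball 0 r. summable (\<lambda>n. z ^ n *\<^sub>C fps_nth u n)"
    by (elim exE conjE)
  define z where "z = complex_of_real (r / 2)"
  have z: "cmod z = r / 2" "z \<in> ball 0 r" using r(1) by (auto simp: z_def)
  from bspec[OF r(2) z(2)] have "Bseq (\<lambda>n. z ^ n *\<^sub>C fps_nth u n)"
    by (rule summable_imp_Bseq)
  then obtain K where K: "K > 0" "\<And>n. norm (z ^ n *\<^sub>C fps_nth u n) \<le> K"
    unfolding Bseq_def by blast
  show thesis
  proof (rule that[of K "2 / r"])
    show "norm (fps_nth u n) \<le> K * (2 / r) ^ n" for n
      using K(2)[of n] r(1)
      by (simp add: norm_scaleC norm_power z(1) power_divide field_simps)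
  qed (use K r in auto)
qed

text \<open>The sum \<open>a / (1 - z)\<close> has its only possible pole at 1. In the left
  half-plane \<open>cmod (1 - z)\<close> is at least 1, so the function is even bounded there by
  \<open>norm a\<close>.\<close>

lemma extends_with_q_growth_geometric:
  fixes a :: "'e::complex_banach"
  assumes "q > 1" "s > 0"
  shows "extends_with_q_growth q s pi (Abs_fps (\<lambda>_. a))"
proof -
  let ?f = "\<lambda>z. inverse (1 - z) *\<^sub>C a"
  \<comment> \<open>The real part has the sign of \<open>cos \<phi> = - cos (\<phi> - pi)\<close>,
    which is negative because \<open>\<phi>\<close> is within \<open>pi / 2\<close> of
    \<open>pi\<close>.\<close>
  have Re: "Re z < 0" if z: "z \<in> sector pi pi" for z
  proof -
    from z obtain r \<phi> where "z = complex_of_real r * cis \<phi>" "0 < r" "\<bar>\<phi> - pi\<bar> < pi / 2"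
      unfolding sector_def by auto
    moreover from this have "cos (\<phi> - pi) > 0"
      by (intro cos_gt_zero_pi) linarith+
    ultimately show ?thesis by (simp add: cos_diff mult_pos_neg)
  qed
  have sums: "(\<lambda>n. z ^ n *\<^sub>C fps_nth (Abs_fps (\<lambda>_. a)) n) sums ?f z" if "z \<in> ball 0 1" for z
    using bounded_linear.sums[OF scaleC.bounded_linear_left geometric_sums[of z]] that
    by (simp add: divide_inverse)
  have "vholomorphic_on ?f (ball 0 1 \<union> sector pi pi)"
    unfolding vholomorphic_on_def
  proof
    fix z assume "z \<in> ball 0 1 \<union> sector pi pi"
    then have "z \<noteq> 1" using Re by force
    then have "((\<lambda>z. inverse (1 - z)) has_field_derivative (inverse (1 - z))\<^sup>2)
        (at z within (ball 0 1 \<union> sector pi pi))"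
      by (auto intro!: derivative_eq_intros simp: power2_eq_square)
    then have "(?f has_derivative (\<lambda>h. ((inverse (1 - z))\<^sup>2 * h) *\<^sub>C a))
        (at z within (ball 0 1 \<union> sector pi pi))"
      unfolding has_field_derivative_def
      by (rule bounded_linear.has_derivative[OF scaleC.bounded_linear_left])
    then show "\<exists>D. (?f has_derivative (\<lambda>h. h *\<^sub>C D)) (at z within (ball 0 1 \<union> sector pi pi))"
      by (intro exI[of _ "(inverse (1 - z))\<^sup>2 *\<^sub>C a"]) (simp add: scaleC_scaleC mult.commute)
  qed
  moreover have "q_exp_growth_on q s ?f (sector pi pi)"
    unfolding q_exp_growth_on_def
  proof (intro exI conjI ballI)
    \<comment> \<open>The added 1 keeps the constant positive when \<open>a = 0\<close>; the shift
      is 1 and the exponent 0.\<close>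
    show "norm a + 1 > 0" "(1::real) > 0" by (auto intro: add_nonneg_pos)
    fix t assume "t \<in> sector pi pi"
    then have "1 \<le> cmod (1 - t)" using Re[of t] complex_Re_le_cmod[of "1 - t"] by simp
    then have "inverse (cmod (1 - t)) \<le> 1" by (rule inverse_le_1_iff[THEN iffD2, OF disjI2])
    then have "norm (?f t) \<le> 1 * norm a"
      unfolding norm_scaleC norm_inverse by (rule mult_right_mono) simp
    also have "\<dots> \<le> (norm a + 1) * 1" by simp
    also have "\<dots> \<le> (norm a + 1) * exp ((ln (cmod t + 1))\<^sup>2 / (2 * s * ln q))"
      using assms by (intro mult_left_mono) auto
    also have "\<dots> = \<dots> * (cmod t + 1) powr 0"
      using norm_ge_zero[of t] by (simp add: add_nonneg_eq_0_iff)
    finally show "norm (?f t) \<le>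
      (norm a + 1) * exp ((ln (cmod t + 1))\<^sup>2 / (2 * s * ln q)) * (cmod t + 1) powr 0" .
  qed
  moreover have "fps_convergent (Abs_fps (\<lambda>_. a))"
    unfolding fps_convergent_def using sums sums_summable zero_less_one by blast
  ultimately show ?thesis
    unfolding extends_with_q_growth_def
    using sums pi_gt_zero by (intro conjI exI[of _ pi] exI[of _ 1] exI[of _ ?f]) auto
qed

section \<open>Elimination of the q-Borel transform and reweighting of coefficients\<close>

text \<open>\<open>q_borel\<close> divides coefficients by nonzero weights, so it commutes with
  \<open>moment_borel\<close> and is surjective; \<open>q_borel q s u\<close> can therefore be
  replaced by an arbitrary series \<open>v\<close>.\<close>

lemma preserves_q_gevrey_iff:
  assumes "q > 1"
  shows "preserves_q_gevrey TYPE('e::complex_banach) q m \<longleftrightarrow>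
    (\<forall>s>0. \<forall>d. \<forall>v :: 'e fps.
       extends_with_q_growth q s d v \<longleftrightarrow> extends_with_q_growth q s d (moment_borel m v))"
proof -
  have comm: "q_borel q s (moment_borel m u) = moment_borel m (q_borel q s u)"
    for s and u :: "'e fps"
    by (rule fps_ext) (simp add: q_borel_def moment_borel_def)
  have "v = q_borel q s (Abs_fps (\<lambda>n. q powr (s * (real n * (real n - 1) / 2)) *\<^sub>R fps_nth v n))"
    for s and v :: "'e fps"
    using assms by (intro fps_ext) (simp add: q_borel_def moment_borel_def)
  then have all_q_borel: "(\<forall>v :: 'e fps. P v) \<longleftrightarrow> (\<forall>u. P (q_borel q s u))" for P s
    by (intro iffI allI) (blast, rule ssubst[of _ _ P], assumption, rule spec)
  show ?thesis
    unfolding preserves_q_gevrey_def comm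
    by (intro all_cong1 imp_cong refl all_q_borel[symmetric])
qed

text \<open>Order \<open>2 * s\<close> contributes \<open>q powr (s * n - s * n\<^sup>2)\<close>, so
  after multiplication by the growing weight a decay of
  \<open>q powr (s * n - s * n\<^sup>2 / 2)\<close> remains. This beats the geometric factor and any
  power of the factorial, by the ratio test.\<close>

lemma summable_fact_powr_q:
  fixes q s X \<alpha> :: real
  assumes "q > 1" "s > 0" "X > 0"
  shows "summable (\<lambda>n. X ^ n * (fact n powr \<alpha> / q powr (2 * s * (real n * (real n - 1) / 2))) *
    q powr (s * (real n)\<^sup>2 / 2))" (is "summable ?f")
proof -
  \<comment> \<open>The quotient of consecutive terms, in closed form.\<close>
  let ?g = "\<lambda>n. X * real (Suc n) powr \<alpha> * q powr (s / 2 - s * n)"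
  have f: "?f n = X ^ n * fact n powr \<alpha> * q powr (s * n - s * (real n)\<^sup>2 / 2)" for n
  proof -
    have "s * n - s * (real n)\<^sup>2 / 2 = s * (real n)\<^sup>2 / 2 - 2 * s * (real n * (real n - 1) / 2)"
      by (simp add: field_simps power2_eq_square)
    then show ?thesis by (simp add: powr_diff)
  qed
  have step: "?f (Suc n) = ?g n * ?f n" for n
  proof -
    have "s * Suc n - s * (real (Suc n))\<^sup>2 / 2 = (s / 2 - s * n) + (s * n - s * (real n)\<^sup>2 / 2)"
      by (simp add: field_simps power2_eq_square)
    then have "q powr (s * Suc n - s * (real (Suc n))\<^sup>2 / 2) =
        q powr (s / 2 - s * n) * q powr (s * n - s * (real n)\<^sup>2 / 2)"
      by (simp only: powr_add)
    moreover have "(fact (Suc n) :: real) powr \<alpha> = real (Suc n) powr \<alpha> * fact n powr \<alpha>"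
      by (simp only: fact_Suc of_nat_fact powr_mult of_nat_mult)
    ultimately show ?thesis
      unfolding f by (simp only: power_Suc mult_ac)
  qed
  have pos: "?f n \<ge> 0" for n using assms by simp
  have "?g \<longlonglongrightarrow> 0" using assms by real_asymp
  then have "\<forall>\<^sub>F n in sequentially. ?g n < 1 / 2" by (rule order_tendstoD) simp
  then obtain N where N: "\<And>n. n \<ge> N \<Longrightarrow> ?g n < 1 / 2"
    unfolding eventually_sequentially by blast
  show ?thesis
  proof (rule summable_ratio_test[of "1 / 2" N])
    show "norm (?f (Suc n)) \<le> 1 / 2 * norm (?f n)" if "n \<ge> N" for n
      using mult_right_mono[OF less_imp_le[OF N[OF that]] pos[of n]] pos[of n] pos[of "Suc n"]
      unfolding real_norm_def step[symmetric] by (simp only: abs_of_nonneg)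
  qed simp
qed

text \<open>The factor \<open>a n / b n\<close> differs from \<open>1\<close> by \<open>(a n - b n) / b n\<close>.\<close>

lemma extends_with_q_growth_reweight:
  fixes w :: "'e::complex_banach fps"
  assumes q: "q > 1" and s: "s > 0" and b: "\<And>n. b n > 0"
    and w: "extends_with_q_growth q s d w"
    and small: "\<And>X. X > 0 \<Longrightarrow>
      summable (\<lambda>n. X ^ n * (\<bar>a n - b n\<bar> / b n) * q powr (s * (real n)\<^sup>2 / 2))"
  shows "extends_with_q_growth q s d (Abs_fps (\<lambda>n. (a n / b n) *\<^sub>R fps_nth w n))"
proof -
  \<comment> \<open>The rate \<open>R\<close> of the coefficients of \<open>w\<close> is the value
    of \<open>X\<close> at which \<open>small\<close> is applied.\<close>
  obtain K R where KR: "K > 0" "R > 0" "\<And>n. norm (fps_nth w n) \<le> K * R ^ n"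
    using w fps_convergent_geometric_bound unfolding extends_with_q_growth_def by metis
  define c where "c = Abs_fps (\<lambda>n. ((a n - b n) / b n) *\<^sub>R fps_nth w n)"
  have "summable (\<lambda>n. norm (fps_nth c n) * q powr (s * (real n)\<^sup>2 / 2))"
  proof (rule summable_comparison_test'[where N = 0])
    show "summable (\<lambda>n. K * (R ^ n * (\<bar>a n - b n\<bar> / b n) * q powr (s * (real n)\<^sup>2 / 2)))"
      by (intro summable_mult small KR)
    fix n
    have "norm (fps_nth w n) * (\<bar>a n - b n\<bar> / b n * q powr (s * (real n)\<^sup>2 / 2)) \<le>
        K * R ^ n * (\<bar>a n - b n\<bar> / b n * q powr (s * (real n)\<^sup>2 / 2))"
      using b[of n] by (intro mult_right_mono KR) auto
    then show "norm (norm (fps_nth c n) * q powr (s * (real n)\<^sup>2 / 2)) \<le>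
        K * (R ^ n * (\<bar>a n - b n\<bar> / b n) * q powr (s * (real n)\<^sup>2 / 2))"
      using b[of n] by (simp add: c_def mult_ac abs_of_pos)
  qed
  then have "extends_with_q_growth q s d (w + c)"
    by (rule extends_with_q_growth_add[OF q s w])
  also have "w + c = Abs_fps (\<lambda>n. (a n / b n) *\<^sub>R fps_nth w n)"
    using b by (intro fps_ext)
      (simp add: c_def diff_divide_distrib scaleR_diff_left less_imp_neq[symmetric])
  finally show ?thesis .
qed

section \<open>Comparison of the two moment sequences\<close>

theorem theorem5:
  fixes q :: real and m m' :: "nat \<Rightarrow> real"
  assumes "q > 1"
    and "\<And>n. m' n > 0" and "m' 0 = 1"
    and "preserves_q_gevrey TYPE('e::complex_banach) q m'"
    and "\<And>n. m n > 0" and "m 0 = 1"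
    and "\<And>s. s > 0 \<Longrightarrow> \<exists>A>0. \<exists>B>0. \<exists>\<alpha>::real. \<forall>n.
           \<bar>m n - m' n\<bar> \<le> A * B ^ n * (fact n) powr \<alpha> / q powr (s * (real n * (real n - 1) / 2))"
  shows "preserves_q_gevrey TYPE('e) q m"
proof (cases "\<exists>a::'e. a \<noteq> 0")
  \<comment> \<open>In the zero space all formal power series coincide. Otherwise a nonzero vector
    \<open>a\<close> allows \<open>1 / m' n\<close> to be read off from the norm of
    \<open>a /\<^sub>R m' n\<close>.\<close>
  case False
  then have "u = v" for u v :: "'e fps" by (intro fps_ext) metis
  then have "moment_borel m u = u" for u :: "'e fps" by blast
  then show ?thesis unfolding preserves_q_gevrey_def by simp
next
  case True
  then obtain a :: 'e where a: "a \<noteq> 0" by blast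
  note q = assms(1) and m'_pos = assms(2) and m_pos = assms(5)
  have m': "extends_with_q_growth q s d v \<longleftrightarrow> extends_with_q_growth q s d (moment_borel m' v)"
    if "s > 0" for s d and v :: "'e fps"
    using assms(4) that unfolding preserves_q_gevrey_iff[OF q] by blast
  \<comment> \<open>Preservation is applied at \<open>s = 1\<close> in the direction
    \<open>pi\<close>; convergence of the transformed series then bounds its coefficients
    \<open>a /\<^sub>R m' n\<close> geometrically.\<close>
  have "fps_convergent (moment_borel m' (Abs_fps (\<lambda>_. a)))"
    using m'[THEN iffD1, OF zero_less_one extends_with_q_growth_geometric[OF q zero_less_one]]
    unfolding extends_with_q_growth_def by (rule conjunct1)
  then obtain K0 R where KR0: "K0 > 0" "R > 0" "\<And>n. norm (a /\<^sub>R m' n) \<le> K0 * R ^ n"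
    by (rule fps_convergent_geometric_bound) (auto simp: moment_borel_def)
  define K where "K = K0 / norm a"
  have K: "K > 0" using KR0 a by (simp add: K_def)
  have KR: "1 / m' n \<le> K * R ^ n" for n
    using KR0(3)[of n] m'_pos[of n] a by (simp add: K_def field_simps)
  define e where "e n = \<bar>m n - m' n\<bar>" for n
  have e_small: "summable (\<lambda>n. X ^ n * e n * q powr (s * (real n)\<^sup>2 / 2))"
    if X: "X > 0" and s: "s > 0" for X s
  proof -
    \<comment> \<open>Taking the hypothesis at \<open>2 * s\<close> leaves room for the weight
      \<open>q powr (s * n\<^sup>2 / 2)\<close>.\<close>
    obtain A B \<alpha> where AB: "A > 0" "B > 0"
      "\<And>n. e n \<le> A * B ^ n * fact n powr \<alpha> / q powr (2 * s * (real n * (real n - 1) / 2))"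
      using assms(7)[of "2 * s"] s unfolding e_def by (elim meta_impE exE conjE) auto
    show ?thesis
    proof (rule summable_comparison_test'[where N = 0])
      show "summable (\<lambda>n. A * ((X * B) ^ n *
          (fact n powr \<alpha> / q powr (2 * s * (real n * (real n - 1) / 2))) *
          q powr (s * (real n)\<^sup>2 / 2)))"
        using X AB by (intro summable_mult summable_fact_powr_q q s) auto
      fix n
      have "X ^ n * e n * q powr (s * (real n)\<^sup>2 / 2) \<le>
         X ^ n * (A * B ^ n * fact n powr \<alpha> / q powr (2 * s * (real n * (real n - 1) / 2))) *
          q powr (s * (real n)\<^sup>2 / 2)"
        using X by (intro mult_right_mono mult_left_mono AB(3)) auto
      also have "\<dots> = A * ((X * B) ^ n *
          (fact n powr \<alpha> / q powr (2 * s * (real n * (real n - 1) / 2))) *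
          q powr (s * (real n)\<^sup>2 / 2))"
        by (simp add: power_mult_distrib)
      finally show "norm (X ^ n * e n * q powr (s * (real n)\<^sup>2 / 2)) \<le> \<dots>"
        using X by (simp add: e_def)
    qed
  qed
  \<comment> \<open>Dividing by \<open>m' n\<close> costs at most \<open>K * R ^ n\<close>, which is
    absorbed by passing from \<open>X\<close> to \<open>X * R\<close>.\<close>
  have small: "summable (\<lambda>n. X ^ n * (e n / m' n) * q powr (s * (real n)\<^sup>2 / 2))"
    if X: "X > 0" and s: "s > 0" for X s
  proof (rule summable_comparison_test'[where N = 0])
    show "summable (\<lambda>n. K * ((X * R) ^ n * e n * q powr (s * (real n)\<^sup>2 / 2)))"
      using X s KR0 by (intro summable_mult e_small) auto
    fix n
    have "X ^ n * e n * q powr (s * (real n)\<^sup>2 / 2) * (1 / m' n) \<le>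
        X ^ n * e n * q powr (s * (real n)\<^sup>2 / 2) * (K * R ^ n)"
      using X by (intro mult_left_mono KR) (auto simp: e_def)
    then show "norm (X ^ n * (e n / m' n) * q powr (s * (real n)\<^sup>2 / 2)) \<le>
        K * ((X * R) ^ n * e n * q powr (s * (real n)\<^sup>2 / 2))"
      using X m'_pos[of n] by (simp add: e_def power_mult_distrib mult_ac)
  qed
  \<comment> \<open>The relative error \<open>e n / m' n\<close> tends to 0, so it is eventually
    below one half. This carries the smallness relative to \<open>m'\<close> over to
    \<open>m\<close>.\<close>
  have half: "\<forall>\<^sub>F n in sequentially. m' n \<le> 2 * m n"
  proof -
    have "(\<lambda>n. e n / m' n * q powr ((real n)\<^sup>2 / 2)) \<longlonglongrightarrow> 0"
      using small[of 1 1] by (intro summable_LIMSEQ_zero) simp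
    then have "\<forall>\<^sub>F n in sequentially. e n / m' n * q powr ((real n)\<^sup>2 / 2) < 1 / 2"
      by (rule order_tendstoD) simp
    then show ?thesis
    proof eventually_elim
      case (elim n)
      have "e n / m' n * 1 \<le> e n / m' n * q powr ((real n)\<^sup>2 / 2)"
        using q m'_pos[of n] by (intro mult_left_mono ge_one_powr_ge_zero) (auto simp: e_def)
      with elim have "e n / m' n < 1 / 2" by linarith
      then have "2 * \<bar>m n - m' n\<bar> < m' n" using m'_pos[of n] by (simp add: e_def field_simps)
      then show ?case by argo
    qed
  qed
  have small': "summable (\<lambda>n. X ^ n * (e n / m n) * q powr (s * (real n)\<^sup>2 / 2))"
    if X: "X > 0" and s: "s > 0" for X s
  proof (rule summable_comparison_test_ev)
    show "summable (\<lambda>n. 2 * (X ^ n * (e n / m' n) * q powr (s * (real n)\<^sup>2 / 2)))"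
      by (intro summable_mult small X s)
    show "\<forall>\<^sub>F n in sequentially. norm (X ^ n * (e n / m n) * q powr (s * (real n)\<^sup>2 / 2)) \<le>
        2 * (X ^ n * (e n / m' n) * q powr (s * (real n)\<^sup>2 / 2))"
      using half
    proof eventually_elim
      case (elim n)
      have "1 / m n \<le> 2 / m' n" using elim m_pos[of n] m'_pos[of n] by (simp add: field_simps)
      then have "X ^ n * e n * q powr (s * (real n)\<^sup>2 / 2) * (1 / m n) \<le>
          X ^ n * e n * q powr (s * (real n)\<^sup>2 / 2) * (2 / m' n)"
        using X by (intro mult_left_mono) (auto simp: e_def)
      then show ?case using X m_pos[of n] by (simp add: e_def mult_ac)
    qed
  qed
  have "extends_with_q_growth q s d v \<longleftrightarrow> extends_with_q_growth q s d (moment_borel m v)"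
    if s: "s > 0" for s d and v :: "'e fps"
  proof -
    have nz: "m n \<noteq> 0" "m' n \<noteq> 0" for n
      using m_pos[of n] m'_pos[of n] by auto
    \<comment> \<open>Both directions compare the transforms of \<open>v\<close> by reweighting: the
      factor \<open>m' n / m n\<close> turns the one for \<open>m'\<close> into the one for
      \<open>m\<close> and is controlled by \<open>small'\<close>; the inverse factor is controlled
      by \<open>small\<close>.\<close>
    have "extends_with_q_growth q s d (moment_borel m v)"
      if "extends_with_q_growth q s d (moment_borel m' v)"
    proof -
      have "extends_with_q_growth q s d
          (Abs_fps (\<lambda>n. (m' n / m n) *\<^sub>R fps_nth (moment_borel m' v) n))"
        using small'[OF _ s]
        by (intro extends_with_q_growth_reweight q s m_pos that)
          (simp add: e_def abs_minus_commute)
      also have "Abs_fps (\<lambda>n. (m' n / m n) *\<^sub>R fps_nth (moment_borel m' v) n) = moment_borel m v"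
        by (rule fps_ext) (simp add: moment_borel_def nz field_simps)
      finally show ?thesis .
    qed
    moreover have "extends_with_q_growth q s d (moment_borel m' v)"
      if "extends_with_q_growth q s d (moment_borel m v)"
    proof -
      have "extends_with_q_growth q s d
          (Abs_fps (\<lambda>n. (m n / m' n) *\<^sub>R fps_nth (moment_borel m v) n))"
        using small[OF _ s]
        by (intro extends_with_q_growth_reweight q s m'_pos that) (simp add: e_def)
      also have "Abs_fps (\<lambda>n. (m n / m' n) *\<^sub>R fps_nth (moment_borel m v) n) = moment_borel m' v"
        by (rule fps_ext) (simp add: moment_borel_def nz field_simps)
      finally show ?thesis .
    qed
    ultimately show ?thesis using m'[OF s] by blast
  qed
  then show ?thesis unfolding preserves_q_gevrey_iff[OF q] by blast
qed

end
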